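(* Let a catalysis be implemented with a catalysis unitary $U_{AB}$ on $\mathcal{H}_A\otimes\mathcal{H}_B$ and a catalyst $\sigma_B$. Let $C$ be a system purifying $\sigma_B$, with purification $\sigma_{BC}=(\sqrt{\sigma_B}\otimes\mathbb{1}_C)|\Gamma\rangle\langle\Gamma|_{BC}(\sqrt{\sigma_B}\otimes\mathbb{1}_C)$, where $|\Gamma\rangle_{BC}=\sum_i|i\rangle_B|i\rangle_C$ is an unnormalized maximally entangled state. Then the corresponding recovery map for the system $AC$ is the partial transpose $U_{AC}^{T_B}$, since $U_{AB}$ commutes with $\sigma_B$ (that is, with $\mathbb{1}_A\otimes\sigma_B$) and hence, for any $\kappa_A$, $$U_{AB}\,(\kappa_A\otimes\sigma_{BC})\,U_{AB}^\dagger=U_{AC}^{T_B}\,(\kappa_A\otimes\sigma_{BC})\,U_{AC}^{T_B\,\dagger}.$$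
   Context: All Hilbert spaces are finite-dimensional. A unitary $U$ on $\mathcal{H}_A\otimes\mathcal{H}_B$ is a catalysis unitary, compatible with the catalyst (quantum state) $\sigma_B$, if there is a unitary $V$ on $\mathcal{H}_B$ such that $\mathrm{Tr}_A\,U(\rho_A\otimes\sigma_B)U^\dagger=V\sigma_BV^\dagger$ for all states $\rho$ on $A$; the catalysis it implements is the channel $\rho\mapsto\mathrm{Tr}_B\,U(\rho_A\otimes\sigma_B)U^\dagger$ on $A$. $\kappa_A$ denotes a state on $A$. $U_{AC}^{T_B}$ denotes the partial transpose of $U_{AB}$ on the $B$ factor with respect to the basis $\{|i\rangle\}$ used in $|\Gamma\rangle_{BC}$, regarded as an operator on $AC$ by identifying $C$ with $B$. Identity operators on uninvolved systems are omitted. The recovery map is the unitary operator acting on $AC$ that recovers the quantum information (the input state of $A$) hidden in the correlation between $A$ and $B$ by $U_{AB}$; its existence is known: if $\Psi_{RA}$ is a maximally entangled state of $A$ and a reference $R$, and $\tau_{BC}$ is a purification of the final state $\tau_B$ of the catalyst (which does not depend on the input), there is a unitary $V_{AC}$ with $V_{AC}U_{AB}(\Psi_{RA}\otimes\sigma_{BC})U_{AB}^\dagger V_{AC}^\dagger=\Psi_{RA}\otimes\tau_{BC}$.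
   Formalization: Commutation and the displayed identity are stated when the catalyst returns to σ_B (in general the right side has the purified final state); the recovery map is the adjoint of U_AC^{T_B}, for σ_B of full rank, else a unitary agreeing with that adjoint on A times the support of σ_B transposed. *)

theory Defs
  imports "HOL-Analysis.Analysis"
begin

text \<open>
  A finite-dimensional Hilbert space with a fixed orthonormal basis is \<open>complex ^ 'n\<close>, with the
  basis indexed by the finite type \<open>'n\<close>; operators are square matrices.  The tensor product of
  the spaces with index types \<open>'a\<close> and \<open>'b\<close> has index type \<open>'a \<times> 'b\<close>.  Throughout, \<open>C\<close> has the same
  index type as \<open>B\<close>, which is the identification of the two systems.
\<close>

definition adj :: "complex ^ 'n ^ 'm \<Rightarrow> complex ^ 'm ^ 'n" where
  "adj A = (\<chi> i j. cnj (A $ j $ i))"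

definition unitary :: "complex ^ 'n::finite ^ 'n \<Rightarrow> bool" where
  "unitary U \<longleftrightarrow> adj U ** U = mat 1 \<and> U ** adj U = mat 1"

definition psd :: "complex ^ 'n::finite ^ 'n \<Rightarrow> bool" where
  "psd A \<longleftrightarrow> adj A = A \<and> (\<forall>x. 0 \<le> Re (\<Sum>i\<in>UNIV. cnj (x $ i) * (A *v x) $ i))"

definition density_op :: "complex ^ 'n::finite ^ 'n \<Rightarrow> bool" where
  "density_op \<rho> \<longleftrightarrow> psd \<rho> \<and> trace \<rho> = 1"

definition psd_sqrt :: "complex ^ 'n::finite ^ 'n \<Rightarrow> complex ^ 'n ^ 'n" where
  "psd_sqrt A = (THE S. psd S \<and> S ** S = A)"

definition ketbra :: "complex ^ 'n \<Rightarrow> complex ^ 'n ^ 'n" where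
  "ketbra v = (\<chi> i j. v $ i * cnj (v $ j))"

definition kron ::
    "complex ^ 'm::finite ^ 'm \<Rightarrow> complex ^ 'n::finite ^ 'n \<Rightarrow> complex ^ ('m \<times> 'n) ^ ('m \<times> 'n)" where
  "kron A B = (\<chi> p q. A $ fst p $ fst q * B $ snd p $ snd q)"

definition ptrace_fst :: "complex ^ ('m::finite \<times> 'n::finite) ^ ('m \<times> 'n) \<Rightarrow> complex ^ 'n ^ 'n" where
  "ptrace_fst X = (\<chi> j k. \<Sum>i\<in>UNIV. X $ (i, j) $ (i, k))"

definition ptrace_snd :: "complex ^ ('m::finite \<times> 'n::finite) ^ ('m \<times> 'n) \<Rightarrow> complex ^ 'm ^ 'm" where
  "ptrace_snd X = (\<chi> i j. \<Sum>k\<in>UNIV. X $ (i, k) $ (j, k))"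

text \<open>Partial transpose on the second factor, sending \<open>X \<otimes> Y\<close> to \<open>X \<otimes> Y\<^sup>T\<close>.\<close>

definition ptranspose_snd ::
    "complex ^ ('m::finite \<times> 'n::finite) ^ ('m \<times> 'n) \<Rightarrow> complex ^ ('m \<times> 'n) ^ ('m \<times> 'n)" where
  "ptranspose_snd X = (\<chi> p q. X $ (fst p, snd q) $ (fst q, snd p))"

definition reassoc ::
    "complex ^ (('k::finite \<times> 'm::finite) \<times> 'n::finite) ^ (('k \<times> 'm) \<times> 'n) \<Rightarrow>
     complex ^ ('k \<times> ('m \<times> 'n)) ^ ('k \<times> ('m \<times> 'n))" where
  "reassoc X = (\<chi> p q. X $ ((fst p, fst (snd p)), snd (snd p))
                         $ ((fst q, fst (snd q)), snd (snd q)))"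

text \<open>
  Operators on \<open>AB\<close> and on \<open>AC\<close> as operators on \<open>A(BC)\<close>, acting as the identity on the third system.
\<close>

definition on_AB ::
    "complex ^ ('a::finite \<times> 'b::finite) ^ ('a \<times> 'b) \<Rightarrow>
     complex ^ ('a \<times> ('b \<times> 'c::finite)) ^ ('a \<times> ('b \<times> 'c))" where
  "on_AB X = (\<chi> p q. if snd (snd p) = snd (snd q)
     then X $ (fst p, fst (snd p)) $ (fst q, fst (snd q)) else 0)"

definition on_AC ::
    "complex ^ ('a::finite \<times> 'c::finite) ^ ('a \<times> 'c) \<Rightarrow>
     complex ^ ('a \<times> ('b::finite \<times> 'c)) ^ ('a \<times> ('b \<times> 'c))" where
  "on_AC X = (\<chi> p q. if fst (snd p) = fst (snd q)
     then X $ (fst p, snd (snd p)) $ (fst q, snd (snd q)) else 0)"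

definition conj_by :: "complex ^ 'n::finite ^ 'n \<Rightarrow> complex ^ 'n ^ 'n \<Rightarrow> complex ^ 'n ^ 'n" where
  "conj_by U X = U ** X ** adj U"

text \<open>The state of the catalyst after the interaction, for the input \<open>\<rho>\<close>.\<close>

definition catalyst_out ::
    "complex ^ ('a::finite \<times> 'b::finite) ^ ('a \<times> 'b) \<Rightarrow> complex ^ 'b ^ 'b \<Rightarrow>
     complex ^ 'a ^ 'a \<Rightarrow> complex ^ 'b ^ 'b" where
  "catalyst_out U \<sigma> \<rho> = ptrace_fst (conj_by U (kron \<rho> \<sigma>))"

definition catalysis_unitary ::
    "complex ^ ('a::finite \<times> 'b::finite) ^ ('a \<times> 'b) \<Rightarrow> complex ^ 'b ^ 'b \<Rightarrow> bool" where
  "catalysis_unitary U \<sigma> \<longleftrightarrow> unitary U \<and>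
     (\<exists>V. unitary V \<and> (\<forall>\<rho>. density_op \<rho> \<longrightarrow> catalyst_out U \<sigma> \<rho> = conj_by V \<sigma>))"

definition Gamma :: "complex ^ ('b::finite \<times> 'b)" where
  "Gamma = (\<chi> p. if fst p = snd p then 1 else 0)"

definition canonical_purification ::
    "complex ^ 'b::finite ^ 'b \<Rightarrow> complex ^ ('b \<times> 'b) ^ ('b \<times> 'b)" where
  "canonical_purification \<sigma> =
     kron (psd_sqrt \<sigma>) (mat 1) ** ketbra Gamma ** kron (psd_sqrt \<sigma>) (mat 1)"

definition purifies ::
    "complex ^ ('b::finite \<times> 'c::finite) ^ ('b \<times> 'c) \<Rightarrow> complex ^ 'b ^ 'b \<Rightarrow> bool" where
  "purifies \<omega> \<tau> \<longleftrightarrow> (\<exists>v. norm v = 1 \<and> \<omega> = ketbra v) \<and> ptrace_snd \<omega> = \<tau>"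

text \<open>The reference \<open>R\<close> is a copy of \<open>A\<close>.\<close>

definition maximally_entangled :: "complex ^ ('a::finite \<times> 'a) ^ ('a \<times> 'a) \<Rightarrow> bool" where
  "maximally_entangled \<Psi> \<longleftrightarrow> (\<exists>v. norm v = 1 \<and> \<Psi> = ketbra v) \<and>
     ptrace_fst \<Psi> = mat (1 / of_nat CARD('a)) \<and> ptrace_snd \<Psi> = mat (1 / of_nat CARD('a))"

text \<open>
  A unitary \<open>W\<close> on \<open>AC\<close> recovers the input of \<open>A\<close> when the catalyst and its purifying system start in
  \<open>\<sigma>BC\<close>, leaving \<open>BC\<close> in the purification \<open>\<tau>BC\<close> of the final state of the catalyst.  The equation is
  between operators on \<open>R(A(BC))\<close>.
\<close>

definition recovery_map ::
    "complex ^ ('a::finite \<times> 'b::finite) ^ ('a \<times> 'b) \<Rightarrow>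
     complex ^ ('b \<times> 'c::finite) ^ ('b \<times> 'c) \<Rightarrow> complex ^ ('b \<times> 'c) ^ ('b \<times> 'c) \<Rightarrow>
     complex ^ ('a \<times> 'c) ^ ('a \<times> 'c) \<Rightarrow> bool" where
  "recovery_map U \<sigma>BC \<tau>BC W \<longleftrightarrow> unitary W \<and>
     (\<forall>\<rho>. density_op \<rho> \<longrightarrow> purifies \<tau>BC (catalyst_out U (ptrace_snd \<sigma>BC) \<rho>)) \<and>
     (\<forall>\<Psi> :: complex ^ ('a \<times> 'a) ^ ('a \<times> 'a). maximally_entangled \<Psi> \<longrightarrow>
        conj_by (kron (mat 1) (on_AC W))
          (conj_by (kron (mat 1) (on_AB U)) (reassoc (kron \<Psi> \<sigma>BC)))
        = reassoc (kron \<Psi> \<tau>BC))"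

end

(*
  With (x) for the tensor product: U (1 (x) sigma) U^* = 1 (x) tau, because both sides have the same
  Hilbert-Schmidt norm and the same partial trace over A.  Hence U also intertwines the square roots
  s, t and the support projections of sigma and tau.  Under vectorization of s and t, the equation
  U (1 (x) s) = (1 (x) t) U says that U, acting on AB in phi (x) sigma_BC, has the effect of
  M = U^{T_B}, acting on AC in phi (x) tau_BC.
  Evaluating Tr_A U (rho (x) sigma) U^* = tau on all pure rho gives M^* M (1 (x) tau^T) = 1 (x) tau^T,
  so M is isometric on A (x) range(tau^T).  Its adjoint is thus a partial isometry between the supports
  of 1 (x) sigma^T and 1 (x) tau^T; these are unitarily equivalent, so it extends to a unitary recovery
  map, which is M^* itself when sigma is invertible.
*)
theory Submission
  imports Defs
begin

section \<open>Matrix algebra, adjoints and the real inner product\<close>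

lemma matrix_add_rdistrib:
  "(B + C) ** A = B ** A + C ** (A :: 'a::semiring_1 ^ 'k::finite ^ 'n::finite)"
  by (vector matrix_matrix_mult_def sum.distrib[symmetric] field_simps)

lemma matrix_diff_ldistrib:
  "A ** (B - C) = A ** B - A ** (C :: 'a::ring_1 ^ 'k::finite ^ 'n::finite)"
  by (vector matrix_matrix_mult_def sum_subtractf[symmetric] algebra_simps)

lemma matrix_diff_rdistrib:
  "(B - C) ** A = B ** A - C ** (A :: 'a::ring_1 ^ 'k::finite ^ 'n::finite)"
  by (vector matrix_matrix_mult_def sum_subtractf[symmetric] algebra_simps)

lemma matrix_mul_scaleR_left:
  "(c *\<^sub>R A) ** B = c *\<^sub>R (A ** (B :: 'a::real_algebra_1 ^ 'k::finite ^ 'n::finite))"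
  by (vector matrix_matrix_mult_def scaleR_right.sum)

lemma matrix_mul_scaleR_right:
  "A ** (c *\<^sub>R B) = c *\<^sub>R (A ** (B :: 'a::real_algebra_1 ^ 'k::finite ^ 'n::finite))"
  by (vector matrix_matrix_mult_def scaleR_right.sum)

lemma matrix_scaleR_mul_vector: "(c *\<^sub>R A) *v x = c *\<^sub>R (A *v x)"
  for A :: "'a::real_algebra_1 ^ 'n::finite ^ 'm::finite"
  by (vector matrix_vector_mult_def scaleR_right.sum)

lemma matrix_mul_zero_left [simp]:
  "0 ** (A :: 'a::semiring_1 ^ 'k::finite ^ 'n::finite) = 0"
  by (vector matrix_matrix_mult_def)

lemma matrix_mul_zero_right [simp]:
  "A ** (0 :: 'a::semiring_1 ^ 'k::finite ^ 'n::finite) = 0"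
  by (vector matrix_matrix_mult_def)

lemmas matrix_distribs = matrix_add_ldistrib matrix_add_rdistrib
  matrix_diff_ldistrib matrix_diff_rdistrib matrix_mul_scaleR_left matrix_mul_scaleR_right

lemma adj_adj [simp]: "adj (adj A) = A"
  by (simp add: adj_def vec_eq_iff)

lemma adj_mult: "adj (A ** B) = adj B ** adj (A :: complex ^ 'n::finite ^ 'm)"
  by (simp add: adj_def vec_eq_iff matrix_matrix_mult_def mult.commute)

lemma adj_mat1 [simp]: "adj (mat 1 :: complex ^ 'n::finite ^ 'n) = mat 1"
  by (simp add: adj_def vec_eq_iff mat_def)

lemma adj_zero [simp]: "adj 0 = 0"
  by (simp add: adj_def vec_eq_iff)

lemma adj_add: "adj (A + B) = adj A + adj B"
  by (simp add: adj_def vec_eq_iff)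

lemma adj_diff: "adj (A - B) = adj A - adj B"
  by (simp add: adj_def vec_eq_iff)

lemma adj_scaleR: "adj (c *\<^sub>R A) = c *\<^sub>R adj A"
  by (simp add: adj_def vec_eq_iff)

lemma inner_complex_vec: "x \<bullet> y = Re (\<Sum>i\<in>UNIV. cnj (x $ i) * y $ i)"
  for x y :: "complex ^ 'n::finite"
  by (simp add: inner_vec_def inner_complex_def)

text \<open>The form of a Hermitian matrix is real, so the real inner product captures it
  fully.\<close>

lemma psd_iff: "psd A \<longleftrightarrow> adj A = A \<and> (\<forall>x. 0 \<le> x \<bullet> (A *v x))"
  by (simp add: psd_def inner_complex_vec)

lemma inner_adj: "(adj A *v x) \<bullet> y = x \<bullet> (A *v y)"
  for A :: "complex ^ 'n::finite ^ 'm::finite"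
proof -
  have "(\<Sum>i\<in>UNIV. cnj ((adj A *v x) $ i) * y $ i)
      = (\<Sum>i\<in>UNIV. \<Sum>j\<in>UNIV. cnj (x $ j) * A $ j $ i * y $ i)"
    by (simp add: matrix_vector_mult_def adj_def sum_distrib_left sum_distrib_right mult_ac)
  also have "\<dots> = (\<Sum>j\<in>UNIV. \<Sum>i\<in>UNIV. cnj (x $ j) * A $ j $ i * y $ i)"
    by (rule sum.swap)
  also have "\<dots> = (\<Sum>j\<in>UNIV. cnj (x $ j) * (A *v y) $ j)"
    by (simp add: matrix_vector_mult_def sum_distrib_left mult_ac)
  finally show ?thesis
    by (simp only: inner_complex_vec)
qed

lemma inner_mult_adj: "x \<bullet> (adj A *v y) = (A *v x) \<bullet> y"
  for A :: "complex ^ 'n::finite ^ 'm::finite"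
  using inner_adj[of "adj A"] by simp

lemma inner_matrix: "A \<bullet> B = Re (trace (adj A ** B))"
  for A B :: "complex ^ 'n::finite ^ 'm::finite"
proof -
  have "A \<bullet> B = (\<Sum>i\<in>UNIV. \<Sum>j\<in>UNIV. Re (cnj (A $ i $ j) * B $ i $ j))"
    by (simp add: inner_vec_def inner_complex_def)
  also have "\<dots> = (\<Sum>j\<in>UNIV. \<Sum>i\<in>UNIV. Re (cnj (A $ i $ j) * B $ i $ j))"
    by (rule sum.swap)
  finally show ?thesis
    by (simp add: trace_def adj_def matrix_matrix_mult_def)
qed

text \<open>The squared Hilbert-Schmidt norm vanishes. Later the test for products of operators
  being zero.\<close>

lemma adj_mult_self_eq_0:
  fixes A :: "complex ^ 'n::finite ^ 'm::finite"
  assumes "adj A ** A = 0"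
  shows "A = 0"
  using inner_matrix[of A A] assms by (simp add: trace_def)

section \<open>Positive operators and uniqueness of the square root\<close>

lemma psd_conj: "psd A \<Longrightarrow> psd (adj M ** A ** M)"
  for A :: "complex ^ 'n::finite ^ 'n" and M :: "complex ^ 'm::finite ^ 'n"
  by (simp add: psd_iff adj_mult matrix_mul_assoc inner_mult_adj flip: matrix_vector_mul_assoc)

lemma psd_adj_mult: "psd (adj M ** M)"
  for M :: "complex ^ 'm::finite ^ 'n::finite"
  by (simp add: psd_iff adj_mult inner_mult_adj flip: matrix_vector_mul_assoc)

lemma psd_sum: "psd A \<Longrightarrow> psd B \<Longrightarrow> psd (A + B)"
  by (auto simp: psd_iff adj_add matrix_vector_mult_add_rdistrib inner_add_right)

lemma psd_scaleR: "psd A \<Longrightarrow> 0 \<le> c \<Longrightarrow> psd (c *\<^sub>R A)"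
  by (simp add: psd_iff adj_scaleR matrix_scaleR_mul_vector)

text \<open>A zero of a nonnegative form is a minimum; a step from \<open>y\<close> against a
  nonzero \<open>f y\<close> would make the form negative.\<close>

lemma selfadjoint_nonneg_zero:
  fixes f :: "'a::real_inner \<Rightarrow> 'a"
  assumes "linear f" and sym: "\<And>x y. f x \<bullet> y = x \<bullet> f y" and nonneg: "\<And>x. 0 \<le> x \<bullet> f x"
    and "y \<bullet> f y = 0"
  shows "f y = 0"
proof (rule ccontr)
  assume "f y \<noteq> 0"
  define z where "z = f y"
  \<comment> \<open>Then \<open>t * c - 2 * n\<close> is \<open>- n - t\<close>; adding 1 keeps the
    denominator positive when \<open>c = 0\<close>.\<close>
  define n c t where "n = z \<bullet> z" and "c = z \<bullet> f z" and "t = n / (c + 1)"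
  have "0 < n" "0 \<le> c"
    using \<open>f y \<noteq> 0\<close> nonneg by (auto simp: n_def c_def z_def)
  then have "0 < t" "t * (c + 1) = n"
    by (auto simp: t_def)
  have "y \<bullet> f z = n"
    by (metis sym n_def z_def)
  then have "(y - t *\<^sub>R z) \<bullet> f (y - t *\<^sub>R z) = t * (t * c - 2 * n)"
    using assms(4) by (simp add: linear_diff[OF assms(1)] linear_scale[OF assms(1)] inner_diff_left
        inner_diff_right n_def[symmetric] c_def[symmetric] z_def[symmetric] inner_commute algebra_simps)
  moreover have "t * c - 2 * n < 0"
    using \<open>0 < t\<close> \<open>0 < n\<close> \<open>t * (c + 1) = n\<close> by (simp add: algebra_simps)
  ultimately show False
    using nonneg[of "y - t *\<^sub>R z"] \<open>0 < t\<close> by (simp add: mult_less_0_iff not_less zero_le_mult_iff)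
qed

lemma linear_matrix_vector: "linear ((*v) A)"
  for A :: "complex ^ 'n::finite ^ 'm::finite"
  by (simp add: linear_linear)

lemma psd_mult_eq_0:
  assumes "psd A" and "y \<bullet> (A *v y) = 0"
  shows "A *v y = 0"
  using selfadjoint_nonneg_zero[OF linear_matrix_vector, of A y] assms inner_adj[of A]
  by (simp add: psd_iff)

text \<open>
  With \<open>D = S - T\<close>, the equation \<open>S D + D T = 0\<close> makes the nonnegative traces of \<open>D S D\<close> and \<open>D T D\<close>
  sum to zero, whence \<open>S D = T D = 0\<close>.
\<close>

lemma psd_sqrt_unique:
  assumes "psd S" and "psd T" and "S ** S = T ** T"
  shows "S = T"
proof -
  define D where "D = S - T"
  have adjs: "adj S = S" "adj T = T" "adj D = D"
    using assms by (simp_all add: psd_iff D_def adj_diff)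
  have "S ** D + D ** T = 0"
    by (simp add: D_def matrix_distribs assms)
  then have "trace (D ** (S ** D + D ** T)) = 0"
    by (simp add: trace_def)
  moreover have "trace (D ** (D ** T)) = trace (D ** T ** D)"
    by (metis trace_mul_sym matrix_mul_assoc)
  ultimately have "trace (D ** S ** D) + trace (D ** T ** D) = 0"
    by (simp add: matrix_distribs trace_add matrix_mul_assoc)
  then have sum0: "Re (trace (D ** S ** D)) + Re (trace (D ** T ** D)) = 0"
    by (metis plus_complex.sel(1) zero_complex.sel(1))
  \<comment> \<open>The trace is a sum of forms at the columns of \<open>D\<close>: if it is zero, a
    positive \<open>R\<close> kills every column.\<close>
  have "trace (adj D ** (R ** D)) = (\<Sum>i\<in>UNIV. \<Sum>j\<in>UNIV. cnj (D $ j $ i) * (R *v column i D) $ j)" for R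
    by (simp add: trace_def matrix_matrix_mult_def matrix_vector_mult_def column_def adj_def)
  then have tr: "Re (trace (D ** R ** D)) = (\<Sum>i\<in>UNIV. column i D \<bullet> (R *v column i D))" for R
    by (simp add: inner_complex_vec column_def adjs matrix_mul_assoc)
  have nonneg: "0 \<le> column i D \<bullet> (R *v column i D)" if "psd R" for R i
    using that by (simp add: psd_iff)
  have "R ** D = 0" if "psd R" "Re (trace (D ** R ** D)) = 0" for R
  proof -
    have "column i D \<bullet> (R *v column i D) = 0" for i
      using that nonneg[OF that(1)] unfolding tr by (simp add: sum_nonneg_eq_0_iff)
    then have "R *v column i D = 0" for i
      using psd_mult_eq_0 that(1) by blast
    then show ?thesis
      by (simp add: vec_eq_iff matrix_matrix_mult_def matrix_vector_mult_def column_def)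
  qed
  moreover have "0 \<le> Re (trace (D ** R ** D))" if "psd R" for R
    unfolding tr by (simp add: sum_nonneg nonneg that)
  ultimately have "S ** D = 0" "T ** D = 0"
    using sum0 assms(1,2) by (auto simp: add_nonneg_eq_0_iff)
  then have "adj D ** D = 0"
    by (simp add: adjs) (simp add: D_def matrix_distribs)
  then show ?thesis
    using adj_mult_self_eq_0 D_def by fastforce
qed

section \<open>Spectral peeling: square roots and support projections\<close>

lemma ketbra_mult_vector: "ketbra v *v x = (\<Sum>j\<in>UNIV. cnj (v $ j) * x $ j) *s v"
  for v :: "complex ^ 'n::finite"
  by (simp add: vec_eq_iff ketbra_def matrix_vector_mult_def sum_distrib_right sum_distrib_left mult_ac)

lemma sum_cnj_self: "(\<Sum>j\<in>UNIV. cnj (v $ j) * v $ j) = of_real ((norm v)\<^sup>2)"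
  for v :: "complex ^ 'n::finite"
proof -
  have "(\<Sum>j\<in>UNIV. cnj (v $ j) * v $ j) = (\<Sum>j\<in>UNIV. of_real ((norm (v $ j))\<^sup>2))"
    by (intro sum.cong refl) (simp add: complex_norm_square[symmetric] mult.commute)
  then show ?thesis
    by (simp add: norm_vec_def L2_set_def sum_nonneg)
qed

lemma adj_ketbra [simp]: "adj (ketbra v) = ketbra v"
  by (simp add: adj_def ketbra_def vec_eq_iff)

lemma ketbra_idem: "norm v = 1 \<Longrightarrow> ketbra v ** ketbra v = ketbra v"
  for v :: "complex ^ 'n::finite"
proof -
  assume "norm v = 1"
  then have "ketbra v *v (ketbra v *v x) = ketbra v *v x" for x
    using sum_cnj_self[of v]
    by (simp add: ketbra_mult_vector vector_scalar_commute vec.scale)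
  then show ?thesis
    by (simp add: matrix_eq flip: matrix_vector_mul_assoc)
qed

lemma psd_ketbra: "norm v = 1 \<Longrightarrow> psd (ketbra v)"
  for v :: "complex ^ 'n::finite"
  using psd_adj_mult[of "ketbra v"] by (simp add: ketbra_idem)

text \<open>The form attains its maximum \<open>c\<close> on the compact unit sphere at some
  \<open>v\<close>; then \<open>c *\<^sub>R mat 1 - A\<close> is positive with a zero of its form at
  \<open>v\<close>, so it kills \<open>v\<close>.\<close>

lemma psd_top_eigenvector:
  fixes A :: "complex ^ 'n::finite ^ 'n"
  assumes "psd A" "A \<noteq> 0"
  obtains v c where "norm v = 1" "0 < c" "A *v v = c *\<^sub>R v"
proof -
  let ?f = "\<lambda>x. x \<bullet> (A *v x)"
  have "continuous_on (sphere 0 1) ?f"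
    by (intro continuous_intros linear_continuous_on) (simp add: linear_matrix_vector linear_conv_bounded_linear[symmetric])
  moreover have "sphere (0 :: complex ^ 'n) 1 \<noteq> {}"
    by simp
  ultimately obtain v where v: "norm v = 1" and max: "\<And>x. norm x = 1 \<Longrightarrow> ?f x \<le> ?f v"
    using continuous_attains_sup[OF compact_sphere, of 0 1 ?f] by auto
  define c where "c = ?f v"
  have bound: "?f x \<le> c * (x \<bullet> x)" for x
  proof (cases "x = 0")
    case False
    let ?y = "(1 / norm x) *\<^sub>R x"
    have "?f ?y = ?f x / (norm x)\<^sup>2"
      by (simp add: linear_scale[OF linear_matrix_vector] power2_eq_square)
    moreover have "?f ?y \<le> c"
      using False max[of ?y] by (simp add: c_def)
    ultimately show ?thesis
      using False by (simp add: divide_le_eq dot_square_norm)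
  qed simp
  have "c > 0"
  proof (rule ccontr)
    assume "\<not> c > 0"
    then have "c * (x \<bullet> x) \<le> 0" for x :: "complex ^ 'n"
      by (simp add: mult_nonpos_nonneg)
    then have "?f x = 0" for x
      using bound[of x] assms(1) by (meson order_antisym order_trans psd_iff)
    then have "A *v x = 0" for x
      using assms(1) psd_mult_eq_0 by blast
    then show False
      using assms(2) by (simp add: matrix_eq)
  qed
  define B where "B = c *\<^sub>R mat 1 - A"
  have Bv: "B *v x = c *\<^sub>R x - A *v x" for x
    by (simp add: B_def matrix_vector_mult_diff_rdistrib matrix_scaleR_mul_vector)
  have "psd B"
    using assms(1) bound by (simp add: psd_iff Bv inner_diff_right) (simp add: B_def adj_diff adj_scaleR)
  moreover have "v \<bullet> (B *v v) = 0"
    using v by (simp add: Bv inner_diff_right c_def dot_square_norm)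
  ultimately have "B *v v = 0"
    by (rule psd_mult_eq_0)
  then show ?thesis
    using that v \<open>c > 0\<close> by (simp add: Bv)
qed


text \<open>
  The support projection \<open>P\<close> of \<open>A\<close> is characterised by \<open>A ** P = A\<close> together with \<open>P = X ** A\<close>;
  the witness \<open>X\<close> is an inverse of \<open>A\<close> on its range.
\<close>

definition support_proj :: "complex ^ 'n::finite ^ 'n \<Rightarrow> complex ^ 'n ^ 'n \<Rightarrow> bool" where
  "support_proj A P \<longleftrightarrow> adj P = P \<and> A ** P = A \<and> (\<exists>X. P = X ** A)"

lemma support_proj_idem: "support_proj A P \<Longrightarrow> P ** P = P"
  by (auto simp: support_proj_def simp flip: matrix_mul_assoc)

text \<open>Each projection factors through \<open>A\<close>, which absorbs the other, so
  \<open>P ** Q = P\<close> and \<open>Q ** P = Q\<close>; the adjoint of one of these gives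
  equality.\<close>

lemma support_proj_unique:
  assumes "support_proj A P" "support_proj A Q"
  shows "P = Q"
proof -
  obtain X Y where X: "P = X ** A" and Y: "Q = Y ** A"
    using assms by (auto simp: support_proj_def)
  have adjs: "adj P = P" "adj Q = Q" and A: "A ** P = A" "A ** Q = A"
    using assms by (simp_all add: support_proj_def)
  have "P ** Q = P"
    by (simp add: X A flip: matrix_mul_assoc)
  moreover have "Q ** P = Q"
    by (simp add: Y A flip: matrix_mul_assoc)
  ultimately show ?thesis
    using adj_mult[of P Q] by (simp add: adjs)
qed

text \<open>Subtracting \<open>c *\<^sub>R ketbra v\<close> for a top eigenvector \<open>v\<close> enlarges the kernel.\<close>

lemma psd_sqrt_and_support_exist:
  fixes A :: "complex ^ 'n::finite ^ 'n"
  assumes "psd A"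
  shows "\<exists>S P. psd S \<and> S ** S = A \<and> support_proj A P"
  using assms
\<comment> \<open>The measure is the real rank of \<open>A\<close>.\<close>
proof (induction "DIM(complex ^ 'n) - dim {x. A *v x = 0}" arbitrary: A rule: less_induct)
  case less
  show ?case
  proof (cases "A = 0")
    case True
    have "psd (0 :: complex ^ 'n ^ 'n)" "support_proj A (0 :: complex ^ 'n ^ 'n)"
      by (auto simp: psd_iff support_proj_def True)
    then show ?thesis
      using True by (intro exI[of _ 0] exI[of _ 0]) simp
  next
    case False
    obtain v c where v: "norm v = 1" and c: "0 < c" and ev: "A *v v = c *\<^sub>R v"
      using psd_top_eigenvector less.prems False by blast
    define K where "K = ketbra v"
    define B where "B = A - c *\<^sub>R K"
    have KK: "K ** K = K" and adjK: "adj K = K" and "psd K"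
      using v by (simp_all add: K_def ketbra_idem psd_ketbra)
    have adjA: "adj A = A"
      using less.prems by (simp add: psd_iff)
    have AK: "A ** K = c *\<^sub>R K"
      using ev by (simp add: matrix_eq K_def ketbra_mult_vector vec.scale matrix_scaleR_mul_vector
          vec_eq_iff flip: matrix_vector_mul_assoc)
    have KA: "K ** A = c *\<^sub>R K"
      using arg_cong[OF AK, of adj] by (simp add: adj_mult adjK adjA adj_scaleR)
    have BK: "B ** K = 0" and KB: "K ** B = 0"
      by (simp_all add: B_def matrix_distribs AK KA KK)
    have "B = adj (mat 1 - K) ** A ** (mat 1 - K)"
      by (simp add: B_def matrix_distribs AK KA KK adj_diff adjK)
    then have "psd B"
      using psd_conj[OF less.prems] by simp
    have Bv: "B *v x = A *v x - c *\<^sub>R (K *v x)" for x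
      by (simp add: B_def matrix_vector_mult_diff_rdistrib matrix_scaleR_mul_vector)
    have sub: "{x. A *v x = 0} \<subset> {x. B *v x = 0}"
    proof
      show "{x. A *v x = 0} \<subseteq> {x. B *v x = 0}"
      proof clarify
        fix x assume "A *v x = 0"
        then have "c *\<^sub>R (K *v x) = 0"
          by (simp flip: KA matrix_scaleR_mul_vector matrix_vector_mul_assoc)
        with \<open>A *v x = 0\<close> show "B *v x = 0"
          by (simp add: Bv)
      qed
      have "K *v v = v"
        using sum_cnj_self[of v] v by (simp add: K_def ketbra_mult_vector)
      then have "B *v v = 0" "A *v v \<noteq> 0"
        using v c by (auto simp: Bv ev)
      then show "{x. A *v x = 0} \<noteq> {x. B *v x = 0}"
        by blast
    qed
    have subspaces: "subspace {x. M *v x = 0}" for M :: "complex ^ 'n ^ 'n"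
      by (rule linear_subspace_kernel) (rule linear_matrix_vector)
    have "dim {x. A *v x = 0} < dim {x. B *v x = 0}"
      using sub by (intro dim_psubset) (simp add: span_eq_iff[THEN iffD2, OF subspaces])
    moreover have "dim {x. B *v x = 0} \<le> DIM(complex ^ 'n)"
      by (rule dim_subset_UNIV)
    ultimately have "DIM(complex ^ 'n) - dim {x. B *v x = 0} < DIM(complex ^ 'n) - dim {x. A *v x = 0}"
      by linarith
    from less.hyps[OF this \<open>psd B\<close>] obtain S P
      where S: "psd S" "S ** S = B" and P: "support_proj B P"
      by blast
    have adjS: "adj S = S" and adjP: "adj P = P"
      using S P by (auto simp: psd_iff support_proj_def)
    obtain X where X: "P = X ** B" and "B ** P = B"
      using P by (auto simp: support_proj_def)
    \<comment> \<open>\<open>S ** K\<close> has zero norm because \<open>S ** S = B\<close> kills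
      \<open>v\<close>; so \<open>T ** T\<close> below has no cross terms.\<close>
    have "adj (S ** K) ** (S ** K) = K ** (S ** S) ** K"
      by (simp add: adj_mult adjS adjK matrix_mul_assoc)
    then have "adj (S ** K) ** (S ** K) = 0"
      by (simp add: S KB)
    then have SK: "S ** K = 0"
      by (rule adj_mult_self_eq_0)
    have KS: "K ** S = 0"
      using arg_cong[OF SK, of adj] by (simp add: adj_mult adjS adjK)
    have PK: "P ** K = 0"
      by (simp add: X BK flip: matrix_mul_assoc)
    have KP: "K ** P = 0"
      using arg_cong[OF PK, of adj] by (simp add: adj_mult adjP adjK)
    define T where "T = S + sqrt c *\<^sub>R K"
    have "psd T"
      using S(1) \<open>psd K\<close> c by (simp add: T_def psd_sum psd_scaleR)
    moreover have "T ** T = A"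
      using c by (simp add: T_def matrix_distribs SK KS KK S) (simp add: B_def)
    moreover have "support_proj A (P + K)"
      unfolding support_proj_def
    proof (intro conjI exI)
      show "adj (P + K) = P + K"
        by (simp add: adj_add adjP adjK)
      have A: "A = B + c *\<^sub>R K"
        by (simp add: B_def)
      show "A ** (P + K) = A"
        by (simp add: A matrix_distribs \<open>B ** P = B\<close> BK KP KK)
      \<comment> \<open>On the complement of \<open>v\<close> the witness for \<open>B\<close>
        serves; along \<open>v\<close>, \<open>A\<close> is multiplication by
        \<open>c\<close>.\<close>
      show "P + K = (X ** (mat 1 - K) + (1 / c) *\<^sub>R K) ** A"
        using c by (simp add: A matrix_distribs X KB KK flip: matrix_mul_assoc)
    qed
    ultimately show ?thesis
      by blast
  qed
qed

lemma psd_sqrt: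
  assumes "psd A"
  shows "psd (psd_sqrt A)" "psd_sqrt A ** psd_sqrt A = A"
proof -
  have "\<exists>!S. psd S \<and> S ** S = A"
    using psd_sqrt_and_support_exist[OF assms] by (auto intro: psd_sqrt_unique)
  from theI'[OF this] show "psd (psd_sqrt A)" "psd_sqrt A ** psd_sqrt A = A"
    by (simp_all add: psd_sqrt_def)
qed

lemma psd_sqrt_eqI: "psd S \<Longrightarrow> S ** S = A \<Longrightarrow> psd_sqrt A = S"
  unfolding psd_sqrt_def using psd_sqrt_unique by blast

section \<open>Conjugation by unitaries\<close>

lemma conj_by_mult:
  assumes "unitary U"
  shows "conj_by U X ** conj_by U Y = conj_by U (X ** Y)"
proof -
  have "U ** X ** adj U ** (U ** Y ** adj U) = U ** X ** (adj U ** U) ** Y ** adj U"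
    by (simp only: matrix_mul_assoc)
  then show ?thesis
    using assms by (simp only: conj_by_def unitary_def matrix_mul_rid) (simp only: matrix_mul_assoc)
qed

lemma psd_conj_by: "psd X \<Longrightarrow> psd (conj_by U X)"
  using psd_conj[of X "adj U"] by (simp add: conj_by_def)

lemma psd_sqrt_conj_by:
  assumes "unitary U" "psd A"
  shows "psd_sqrt (conj_by U A) = conj_by U (psd_sqrt A)"
  using assms by (intro psd_sqrt_eqI) (simp_all add: psd_conj_by psd_sqrt conj_by_mult)

lemma support_proj_conj_by:
  assumes "unitary U" "support_proj A P"
  shows "support_proj (conj_by U A) (conj_by U P)"
proof -
  obtain X where "P = X ** A"
    using assms(2) by (auto simp: support_proj_def)
  then have "conj_by U P = conj_by U X ** conj_by U A"
    by (simp add: conj_by_mult assms(1))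
  moreover have "adj (conj_by U P) = conj_by U P"
    using assms(2) by (simp add: conj_by_def adj_mult matrix_mul_assoc support_proj_def)
  ultimately show ?thesis
    using assms conj_by_mult[OF assms(1), of A P] by (auto simp: support_proj_def)
qed

text \<open>Passes from conjugation, where uniqueness of roots and supports applies, to
  intertwining, which partial transposition can read.\<close>

lemma conj_by_eq_iff: "unitary U \<Longrightarrow> conj_by U X = Y \<longleftrightarrow> U ** X = Y ** U"
proof -
  assume U: "unitary U"
  have "U ** X ** adj U ** U = U ** X" "Y ** U ** adj U = Y"
    using U by (simp_all add: unitary_def flip: matrix_mul_assoc)
  then show ?thesis
    by (auto simp: conj_by_def)
qed

lemma inner_conj_by:
  assumes "unitary U"
  shows "conj_by U X \<bullet> conj_by U Y = X \<bullet> Y"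
proof -
  have "adj (conj_by U X) ** conj_by U Y = conj_by U (adj X ** Y)"
    using conj_by_mult[OF assms, of "adj X" Y] by (simp add: conj_by_def adj_mult matrix_mul_assoc)
  moreover have "trace (conj_by U (adj X ** Y)) = trace (adj U ** (U ** (adj X ** Y)))"
    unfolding conj_by_def by (rule trace_mul_sym)
  ultimately show ?thesis
    using assms by (simp add: inner_matrix matrix_mul_assoc unitary_def)
qed

lemma trace_conj_by: "unitary U \<Longrightarrow> trace (conj_by U X) = trace X"
  using trace_mul_sym[of "U ** X" "adj U"] by (simp add: conj_by_def unitary_def matrix_mul_assoc)

section \<open>Tensor products, partial traces and density operators\<close>

lemma sum_UNIV_prod: "(\<Sum>p\<in>UNIV. f p) = (\<Sum>i\<in>UNIV. \<Sum>j\<in>UNIV. f (i, j))"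
  for f :: "'i::finite \<times> 'j::finite \<Rightarrow> 'm::comm_monoid_add"
  by (simp add: sum.cartesian_product)

text \<open>Kronecker deltas appear as conditionals; with \<open>sum_if_const\<close> these move
  them out of products and sums until the sums collapse.\<close>

lemmas if_zero_mult =
  if_distrib[of "\<lambda>x. x * c" for c :: complex] if_distrib[of "\<lambda>x. c * x" for c :: complex]
  if_distrib[of cnj]

lemma sum_if_const: "(\<Sum>i\<in>A. if P then f i else 0) = (if P then sum f A else 0)"
  by simp

lemma matrix_prod_eqI:
  "(\<And>i j k l. A $ (i, j) $ (k, l) = B $ (i, j) $ (k, l)) \<Longrightarrow> A = B"
  by (simp add: vec_eq_iff)

lemma matrix_mult_prod_nth:
  "(A ** B) $ p $ q = (\<Sum>i\<in>UNIV. \<Sum>j\<in>UNIV. A $ p $ (i, j) * B $ (i, j) $ q)"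
  for B :: "'c::semiring_1 ^ 'q ^ ('i::finite \<times> 'j::finite)"
  by (simp add: matrix_matrix_mult_def sum_UNIV_prod)

lemma kron_nth [simp]: "kron A B $ (i, j) $ (k, l) = A $ i $ k * B $ j $ l"
  by (simp add: kron_def)

lemma ptranspose_snd_nth [simp]: "ptranspose_snd X $ (i, j) $ (k, l) = X $ (i, l) $ (k, j)"
  by (simp add: ptranspose_snd_def)

lemma kron_mult: "kron A B ** kron C D = kron (A ** C) (B ** D)"
  by (rule matrix_prod_eqI)
    (simp add: matrix_mult_prod_nth, simp add: matrix_matrix_mult_def sum_product mult_ac)

lemma adj_kron: "adj (kron A B) = kron (adj A) (adj B)"
  by (rule matrix_prod_eqI) (simp add: adj_def)

lemma kron_mat1 [simp]: "kron (mat 1) (mat 1) = mat 1"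
  by (rule matrix_prod_eqI) (simp add: mat_def)

lemma kron_id_mult_nth:
  "(kron (mat 1) X ** U) $ (i, j) $ q = (\<Sum>l\<in>UNIV. X $ j $ l * U $ (i, l) $ q)"
proof -
  have "(\<Sum>l\<in>UNIV. mat 1 $ i $ k * X $ j $ l * U $ (k, l) $ q)
      = (if k = i then (\<Sum>l\<in>UNIV. X $ j $ l * U $ (i, l) $ q) else 0)" for k
    by (simp add: mat_def)
  then show ?thesis
    by (simp add: matrix_mult_prod_nth)
qed

lemma mult_kron_id_nth:
  "(U ** kron (mat 1) X) $ p $ (i, j) = (\<Sum>l\<in>UNIV. U $ p $ (i, l) * X $ l $ j)"
proof -
  have "(\<Sum>l\<in>UNIV. U $ p $ (k, l) * (mat 1 $ k $ i * X $ l $ j))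
      = (if k = i then (\<Sum>l\<in>UNIV. U $ p $ (i, l) * X $ l $ j) else 0)" for k
    by (simp add: mat_def)
  then show ?thesis
    by (simp add: matrix_mult_prod_nth)
qed

lemma kron_id_inject:
  assumes "kron (mat 1 :: complex ^ 'a::finite ^ 'a) X = kron (mat 1) Y"
  shows "X = Y"
proof -
  have "X $ i $ j = Y $ i $ j" for i j
    using arg_cong[OF assms, of "\<lambda>Z. Z $ (undefined, i) $ (undefined, j)"] by (simp add: mat_def)
  then show ?thesis
    by (simp add: vec_eq_iff)
qed

lemma conj_by_kron_id:
  "conj_by (kron (mat 1) V) (kron (mat 1) X) = kron (mat 1) (conj_by V X)"
  by (simp add: conj_by_def adj_kron kron_mult)

lemma unitary_kron_id: "unitary V \<Longrightarrow> unitary (kron (mat 1) V)"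
  by (simp add: unitary_def adj_kron kron_mult)

lemma psd_kron_id:
  assumes "psd A"
  shows "psd (kron (mat 1) A)"
proof -
  let ?S = "kron (mat 1) (psd_sqrt A)"
  have "adj ?S ** ?S = kron (mat 1) A"
    using psd_sqrt[OF assms] by (simp add: adj_kron kron_mult psd_iff)
  then show ?thesis
    using psd_adj_mult by metis
qed

lemma psd_sqrt_kron_id:
  "psd A \<Longrightarrow> psd_sqrt (kron (mat 1) A) = kron (mat 1) (psd_sqrt A)"
  by (intro psd_sqrt_eqI) (simp_all add: psd_kron_id psd_sqrt kron_mult)

lemma support_proj_kron_id:
  assumes "support_proj A P"
  shows "support_proj (kron (mat 1) A) (kron (mat 1) P)"
proof -
  obtain X where "P = X ** A"
    using assms by (auto simp: support_proj_def)
  then have "\<exists>Y. kron (mat 1) P = Y ** kron (mat 1) A"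
    by (intro exI[of _ "kron (mat 1) X"]) (simp add: kron_mult)
  then show ?thesis
    using assms unfolding support_proj_def by (intro conjI) (simp_all add: kron_mult adj_kron)
qed

text \<open>The partial trace is the Hilbert-Schmidt adjoint of tensoring with the identity; hence
  it determines projections onto operators \<open>kron (mat 1) Y\<close>.\<close>

lemma inner_kron_id: "X \<bullet> kron (mat 1) Y = ptrace_fst X \<bullet> Y"
proof -
  have "trace (adj X ** kron (mat 1) Y)
      = (\<Sum>i\<in>UNIV. \<Sum>j\<in>UNIV. \<Sum>l\<in>UNIV. cnj (X $ (i, l) $ (i, j)) * Y $ l $ j)"
    by (simp add: trace_def sum_UNIV_prod mult_kron_id_nth adj_def)
  also have "\<dots> = (\<Sum>j\<in>UNIV. \<Sum>i\<in>UNIV. \<Sum>l\<in>UNIV. cnj (X $ (i, l) $ (i, j)) * Y $ l $ j)"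
    by (rule sum.swap)
  also have "\<dots> = (\<Sum>j\<in>UNIV. \<Sum>l\<in>UNIV. \<Sum>i\<in>UNIV. cnj (X $ (i, l) $ (i, j)) * Y $ l $ j)"
    by (intro sum.cong refl sum.swap)
  also have "\<dots> = trace (adj (ptrace_fst X) ** Y)"
    by (simp add: trace_def matrix_matrix_mult_def adj_def ptrace_fst_def sum_distrib_right)
  finally show ?thesis
    by (simp add: inner_matrix)
qed

lemma ptrace_fst_kron_id:
  "ptrace_fst (kron (mat 1 :: complex ^ 'a::finite ^ 'a) Y) = real CARD('a) *\<^sub>R Y"
  by (simp add: ptrace_fst_def vec_eq_iff) (simp add: mat_def scaleR_conv_of_real)

lemma ptrace_fst_scaleR: "ptrace_fst (c *\<^sub>R X) = c *\<^sub>R ptrace_fst X"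
  by (simp add: ptrace_fst_def vec_eq_iff scaleR_right.sum)

lemma density_op_maximally_mixed: "density_op ((1 / real CARD('a)) *\<^sub>R mat 1 :: complex ^ 'a::finite ^ 'a)"
proof -
  have "psd (mat 1 :: complex ^ 'a ^ 'a)"
    using psd_adj_mult[of "mat 1"] by simp
  moreover have "trace (c *\<^sub>R mat 1 :: complex ^ 'a ^ 'a) = of_real (c * real CARD('a))" for c
    by (simp add: trace_def) (simp add: mat_def scaleR_conv_of_real)
  ultimately show ?thesis
    by (simp add: density_op_def psd_scaleR)
qed

lemma density_op_ketbra: "norm v = 1 \<Longrightarrow> density_op (ketbra v)"
  for v :: "complex ^ 'n::finite"
  using sum_cnj_self[of v] by (simp add: density_op_def psd_ketbra) (simp add: trace_def ketbra_def mult.commute)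

lemma density_op_conj_by: "unitary V \<Longrightarrow> density_op A \<Longrightarrow> density_op (conj_by V A)"
  by (simp add: density_op_def psd_conj_by trace_conj_by)

text \<open>
  \<open>1 \<otimes> \<tau>\<close> is the Hilbert-Schmidt projection of \<open>X = U (1 \<otimes> \<sigma>) U\<^sup>\<dagger>\<close> to the operators \<open>1 \<otimes> Y\<close>, and it has
  the same norm as \<open>X\<close> because \<open>\<tau>\<close> is unitarily equivalent to \<open>\<sigma>\<close>; so the two agree.
\<close>

lemma catalysis_conj:
  fixes U :: "complex ^ ('a::finite \<times> 'b::finite) ^ ('a \<times> 'b)"
  assumes "unitary U" "unitary V" "\<tau> = conj_by V \<sigma>"
    and out: "\<And>\<rho>. density_op \<rho> \<Longrightarrow> catalyst_out U \<sigma> \<rho> = \<tau>"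
  shows "conj_by U (kron (mat 1) \<sigma>) = kron (mat 1) \<tau>"
proof -
  let ?d = "real CARD('a)"
  define X where "X = conj_by U (kron (mat 1) \<sigma>)"
  define Y where "Y = kron (mat 1 :: complex ^ 'a ^ 'a) \<tau>"
  have scal: "conj_by U (kron (c *\<^sub>R mat 1) \<sigma>) = c *\<^sub>R X" for c
  proof -
    have "kron (c *\<^sub>R mat 1 :: complex ^ 'a ^ 'a) \<sigma> = c *\<^sub>R kron (mat 1) \<sigma>"
      by (simp add: kron_def vec_eq_iff)
    then show ?thesis
      by (simp add: conj_by_def X_def matrix_distribs)
  qed
  \<comment> \<open>The maximally mixed input turns the catalyst condition into one on
    \<open>X\<close>.\<close>
  have "(1 / ?d) *\<^sub>R ptrace_fst X = \<tau>"
    using out[OF density_op_maximally_mixed] unfolding catalyst_out_def scal ptrace_fst_scaleR .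
  then have "ptrace_fst X = ptrace_fst Y"
    by (auto simp: Y_def ptrace_fst_kron_id)
  then have XY: "X \<bullet> Y = Y \<bullet> Y"
    by (simp add: Y_def inner_kron_id)
  have "Y = conj_by (kron (mat 1) V) (kron (mat 1) \<sigma>)"
    by (simp add: Y_def assms(3) conj_by_kron_id)
  then have "X \<bullet> X = Y \<bullet> Y"
    by (simp add: X_def inner_conj_by assms(1,2) unitary_kron_id)
  then have "(X - Y) \<bullet> (X - Y) = 0"
    using XY by (simp add: inner_diff_left inner_diff_right inner_commute)
  then show ?thesis
    by (simp add: X_def Y_def)
qed

section \<open>Partial transposes and the catalyst condition\<close>

text \<open>Transposing the second factor reverses products there, so a factor changes
  sides.\<close>

lemma ptranspose_snd_kron_id_mult:
  "ptranspose_snd (kron (mat 1) X ** U) = ptranspose_snd U ** kron (mat 1) (transpose X)"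
  by (rule matrix_prod_eqI) (simp add: kron_id_mult_nth mult_kron_id_nth transpose_def mult.commute)

lemma ptranspose_snd_mult_kron_id:
  "ptranspose_snd (U ** kron (mat 1) X) = kron (mat 1) (transpose X) ** ptranspose_snd U"
  by (rule matrix_prod_eqI) (simp add: kron_id_mult_nth mult_kron_id_nth transpose_def mult.commute)

text \<open>The sums over the A output and the B input form a matrix product of partial transposes.
  \<open>L\<close> and \<open>R\<close> differ so that one can absorb the catalyst.\<close>

lemma ptrace_fst_conj_nth:
  "ptrace_fst (L ** kron \<rho> (mat 1) ** adj R) $ j $ k
   = (\<Sum>a\<in>UNIV. \<Sum>a'\<in>UNIV. \<rho> $ a $ a' * (adj (ptranspose_snd R) ** ptranspose_snd L) $ (a', k) $ (a, j))"
proof -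
  let ?f = "\<lambda>i a b a'. L $ (i, j) $ (a, b) * \<rho> $ a $ a' * cnj (R $ (i, k) $ (a', b))"
  have "(L ** kron \<rho> (mat 1)) $ p $ (a', b) = (\<Sum>a\<in>UNIV. L $ p $ (a, b) * \<rho> $ a $ a')" for p a' b
    by (simp add: matrix_mult_prod_nth) (simp add: mat_def if_zero_mult cong: if_cong)
  then have "ptrace_fst (L ** kron \<rho> (mat 1) ** adj R) $ j $ k
      = (\<Sum>i\<in>UNIV. \<Sum>a'\<in>UNIV. \<Sum>b\<in>UNIV. \<Sum>a\<in>UNIV. ?f i a b a')"
    by (simp add: ptrace_fst_def matrix_mult_prod_nth[of "L ** kron \<rho> (mat 1)"] adj_def sum_distrib_right)
  also have "\<dots> = (\<Sum>i\<in>UNIV. \<Sum>a'\<in>UNIV. \<Sum>a\<in>UNIV. \<Sum>b\<in>UNIV. ?f i a b a')"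
    by (intro sum.cong refl sum.swap)
  also have "\<dots> = (\<Sum>i\<in>UNIV. \<Sum>a\<in>UNIV. \<Sum>a'\<in>UNIV. \<Sum>b\<in>UNIV. ?f i a b a')"
    by (intro sum.cong refl sum.swap)
  also have "\<dots> = (\<Sum>a\<in>UNIV. \<Sum>i\<in>UNIV. \<Sum>a'\<in>UNIV. \<Sum>b\<in>UNIV. ?f i a b a')"
    by (rule sum.swap)
  also have "\<dots> = (\<Sum>a\<in>UNIV. \<Sum>a'\<in>UNIV. \<Sum>i\<in>UNIV. \<Sum>b\<in>UNIV. ?f i a b a')"
    by (intro sum.cong refl sum.swap)
  also have "\<dots> = (\<Sum>a\<in>UNIV. \<Sum>a'\<in>UNIV. \<rho> $ a $ a' *
      (adj (ptranspose_snd R) ** ptranspose_snd L) $ (a', k) $ (a, j))"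
    by (simp add: matrix_mult_prod_nth adj_def sum_distrib_left mult_ac)
  finally show ?thesis .
qed

text \<open>Polarization: the sum is the quadratic form of \<open>Z\<close> at \<open>v\<close>,
  which determines \<open>Z\<close> over the complex numbers.\<close>

lemma constant_quadratic_form:
  fixes Z :: "complex ^ 'n::finite ^ 'n"
  assumes "\<And>v. norm v = 1 \<Longrightarrow> (\<Sum>i\<in>UNIV. \<Sum>j\<in>UNIV. ketbra v $ i $ j * Z $ j $ i) = c"
  shows "Z = mat c"
proof -
  define q where "q v = (\<Sum>i\<in>UNIV. \<Sum>j\<in>UNIV. ketbra v $ i $ j * Z $ j $ i)" for v
  have q: "q v = c * (\<Sum>j\<in>UNIV. cnj (v $ j) * v $ j)" for v
  proof (cases "v = 0")
    case True
    then show ?thesis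
      by (simp add: q_def ketbra_def)
  next
    case False
    define u where "u = (1 / norm v) *\<^sub>R v"
    have "ketbra v $ i $ j = of_real ((norm v)\<^sup>2) * ketbra u $ i $ j" for i j
      using False by (simp add: u_def ketbra_def power2_eq_square) (simp add: scaleR_conv_of_real)
    then have "q v = of_real ((norm v)\<^sup>2) * q u"
      by (simp add: q_def sum_distrib_left mult_ac)
    moreover have "q u = c"
      unfolding q_def using False by (intro assms) (simp add: u_def)
    ultimately show ?thesis
      by (simp add: sum_cnj_self)
  qed
  have delta: "(\<Sum>a\<in>UNIV. (axis i s + axis j t :: complex ^ 'n) $ a * f a) = s * f i + t * f j"
    "(\<Sum>a\<in>UNIV. cnj ((axis i s + axis j t :: complex ^ 'n) $ a) * f a) = cnj s * f i + cnj t * f j"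
    for i j s t f
  proof -
    have "(axis i s + axis j t :: complex ^ 'n) $ a * f a
        = (if a = i then s * f i else 0) + (if a = j then t * f j else 0)"
      "cnj ((axis i s + axis j t :: complex ^ 'n) $ a) * f a
        = (if a = i then cnj s * f i else 0) + (if a = j then cnj t * f j else 0)" for a
      by (auto simp: axis_def distrib_right)
    then show "(\<Sum>a\<in>UNIV. (axis i s + axis j t :: complex ^ 'n) $ a * f a) = s * f i + t * f j"
      "(\<Sum>a\<in>UNIV. cnj ((axis i s + axis j t :: complex ^ 'n) $ a) * f a) = cnj s * f i + cnj t * f j"
      by (simp_all only: sum.distrib) simp_all
  qed
  \<comment> \<open>At \<open>axis i s + axis j t\<close>: \<open>t = 0\<close> will give the
    diagonal, \<open>t = 1\<close> and \<open>t = \<i>\<close> the sum and difference of mirrored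
    entries.\<close>
  have *: "s * (cnj s * Z $ i $ i + cnj t * Z $ j $ i) + t * (cnj s * Z $ i $ j + cnj t * Z $ j $ j)
      = c * (cnj s * (axis i s + axis j t) $ i + cnj t * (axis i s + axis j t) $ j)" for i j s t
  proof -
    have "q v = (\<Sum>a\<in>UNIV. v $ a * (\<Sum>b\<in>UNIV. cnj (v $ b) * Z $ b $ a))" for v
      by (simp add: q_def ketbra_def sum_distrib_left mult_ac)
    then show ?thesis
      using q[of "axis i s + axis j t"] by (simp only: delta)
  qed
  have diag: "Z $ i $ i = c" for i
    using *[where i = i and j = i and s = 1 and t = 0] by simp
  have "Z $ i $ j = 0" if "i \<noteq> j" for i j
  proof -
    have "Z $ j $ i + Z $ i $ j = 0"
      using *[where i = i and j = j and s = 1 and t = 1] that by (simp add: diag axis_def)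
    moreover have "Z $ i $ j - Z $ j $ i = 0"
      using *[where i = i and j = j and s = 1 and t = \<i>] that
      by (simp add: diag axis_def algebra_simps)
    ultimately show ?thesis
      by (metis add_cancel_right_left eq_iff_diff_eq_0 mult_2 mult_eq_0_iff zero_neq_numeral)
  qed
  then show ?thesis
    by (simp add: vec_eq_iff mat_def diag)
qed

text \<open>For fixed catalyst indices, the condition makes the form of an A-block constant on unit
  vectors, so the block is scalar: constant catalyst output becomes isometry of the partial
  transpose.\<close>

lemma adj_mult_ptranspose:
  fixes U :: "complex ^ ('a::finite \<times> 'b::finite) ^ ('a \<times> 'b)"
  assumes out: "\<And>\<rho>. density_op \<rho> \<Longrightarrow> catalyst_out U \<sigma> \<rho> = \<tau>"
    and comm: "U ** kron (mat 1) \<sigma> = kron (mat 1) \<tau> ** U"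
  shows "adj (ptranspose_snd U) ** ptranspose_snd U ** kron (mat 1) (transpose \<tau>)
    = kron (mat 1) (transpose \<tau>)"
proof -
  let ?T = "adj (ptranspose_snd U) ** ptranspose_snd (kron (mat 1) \<tau> ** U)"
  have "?T $ (a', k) $ (a, j) = kron (mat 1) (transpose \<tau>) $ (a', k) $ (a, j)" for a' a k j
  proof -
    have "(\<Sum>a\<in>UNIV. \<Sum>a'\<in>UNIV. ketbra v $ a $ a' * (\<chi> a' a. ?T $ (a', k) $ (a, j)) $ a' $ a)
        = \<tau> $ j $ k" if "norm v = 1" for v
    proof -
      \<comment> \<open>Passing \<open>\<sigma>\<close> through \<open>U\<close> makes it
        \<open>\<tau>\<close> and leaves the identity on B as input.\<close>
      have "kron (ketbra v) \<sigma> = kron (mat 1) \<sigma> ** kron (ketbra v) (mat 1)"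
        by (simp add: kron_mult)
      then have "catalyst_out U \<sigma> (ketbra v)
          = ptrace_fst (kron (mat 1) \<tau> ** U ** kron (ketbra v) (mat 1) ** adj U)"
        by (simp add: catalyst_out_def conj_by_def comm matrix_mul_assoc)
      then show ?thesis
        using out[OF density_op_ketbra[OF that]]
          ptrace_fst_conj_nth[of "kron (mat 1) \<tau> ** U" "ketbra v" U j k] by simp
    qed
    then have "(\<chi> a' a. ?T $ (a', k) $ (a, j)) = mat (\<tau> $ j $ k)"
      by (rule constant_quadratic_form)
    then have "?T $ (a', k) $ (a, j) = mat (\<tau> $ j $ k) $ a' $ a"
      by (simp add: vec_eq_iff)
    then show ?thesis
      by (simp add: mat_def transpose_def)
  qed
  then have "?T = kron (mat 1) (transpose \<tau>)"
    by (rule matrix_prod_eqI)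
  then show ?thesis
    by (simp add: ptranspose_snd_kron_id_mult matrix_mul_assoc)
qed

text \<open>
  The partial isometry \<open>adj (M ** Q)\<close> has initial projection \<open>P\<close> and final projection \<open>Q\<close>.  As \<open>V\<close> takes
  \<open>P\<close> to \<open>Q\<close>, it also takes the complement of \<open>P\<close> to that of \<open>Q\<close>, which completes the partial
  isometry to a unitary.
\<close>

lemma partial_isometry_extends:
  assumes "unitary V" and Q: "Q = conj_by V P"
    and adjP: "adj P = P" and PP: "P ** P = P"
    and inter: "M ** Q = P ** M" and iso: "adj M ** M ** Q = Q"
  obtains W where "unitary W" "W ** M ** Q = Q" "W ** P = adj M ** P"
proof -
  have adjQ: "adj Q = Q"
    by (simp add: Q conj_by_def adj_mult adjP matrix_mul_assoc)
  have inter': "Q ** adj M = adj M ** P"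
    using arg_cong[OF inter, of adj] by (simp add: adj_mult adjP adjQ)
  define R where "R = mat 1 - P"
  have RP: "R ** P = 0" and PR: "P ** R = 0" and RR: "R ** R = R" and adjR: "adj R = R"
    by (simp_all add: R_def matrix_distribs PP adj_diff adjP)
  define W where "W = adj M ** P + V ** R"
  have adjW: "adj W = P ** M + R ** adj V"
    by (simp add: W_def adj_add adj_mult adjP adjR)
  \<comment> \<open>Cross terms vanish as \<open>P\<close> and \<open>R\<close> are orthogonal; the
    rest is the projection \<open>Q\<close> plus its complement.\<close>
  have "W ** adj W = adj M ** (P ** P) ** M + adj M ** (P ** R) ** adj V
      + V ** (R ** P) ** M + V ** (R ** R) ** adj V"
    unfolding adjW by (simp add: W_def matrix_distribs matrix_mul_assoc add_ac)
  also have "\<dots> = adj M ** M ** Q + V ** R ** adj V"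
    by (simp add: PP PR RP RR inter flip: matrix_mul_assoc)
  also have "V ** R ** adj V = mat 1 - Q"
    using assms(1) by (simp add: R_def matrix_distribs Q conj_by_def unitary_def)
  finally have "W ** adj W = mat 1"
    by (simp add: iso)
  then have "unitary W"
    by (simp add: unitary_def matrix_left_right_inverse)
  moreover have WP: "W ** P = adj M ** P"
    by (simp add: W_def matrix_distribs PP RP flip: matrix_mul_assoc)
  moreover have "W ** M ** Q = Q"
  proof -
    have "W ** M ** Q = W ** P ** M"
      by (simp add: inter flip: matrix_mul_assoc)
    also have "\<dots> = adj M ** M ** Q"
      by (simp add: WP inter flip: matrix_mul_assoc)
    finally show ?thesis
      by (simp add: iso)
  qed
  ultimately show ?thesis
    using that by blast
qed

section \<open>Purification vectors and the recovery criterion\<close>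

text \<open>The operator \<open>x \<mapsto> x \<otimes> g\<close>, an isometry when \<open>g\<close> is a unit vector.\<close>

definition attach :: "complex ^ 'n::finite \<Rightarrow> complex ^ 'a::finite ^ ('a \<times> 'n)" where
  "attach g = (\<chi> p i. if fst p = i then g $ snd p else 0)"

lemma kron_ketbra:
  "kron \<kappa> (ketbra g) = attach g ** \<kappa> ** adj (attach g)"
proof (rule matrix_prod_eqI)
  fix i j k l
  have "(attach g ** \<kappa>) $ (i, j) $ k = g $ j * \<kappa> $ i $ k" for k
    by (simp add: matrix_matrix_mult_def attach_def if_zero_mult sum_if_const cong: if_cong)
  then show "kron \<kappa> (ketbra g) $ (i, j) $ (k, l) = (attach g ** \<kappa> ** adj (attach g)) $ (i, j) $ (k, l)"
    by (simp add: matrix_matrix_mult_def[of "attach g ** \<kappa>"])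
      (simp add: attach_def adj_def ketbra_def if_zero_mult sum_if_const cong: if_cong)
qed

text \<open>Tensoring with the identity for rectangular \<open>X\<close>, such as
  \<open>attach g\<close>; \<open>kron\<close> takes square matrices only.\<close>

definition amplify :: "complex ^ 'm::finite ^ 'n::finite \<Rightarrow> complex ^ ('r::finite \<times> 'm) ^ ('r \<times> 'n)" where
  "amplify X = (\<chi> p q. if fst p = fst q then X $ snd p $ snd q else 0)"

lemma kron_id_eq_amplify: "kron (mat 1) X = amplify X"
  by (rule matrix_prod_eqI) (simp add: amplify_def mat_def)

lemma amplify_mult:
  "amplify X ** (amplify Y :: complex ^ ('r::finite \<times> 'm::finite) ^ ('r \<times> 'n::finite)) = amplify (X ** Y)"
proof (rule matrix_prod_eqI)
  fix i j and k :: 'r and l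
  have "(\<Sum>n\<in>UNIV. amplify X $ (i, j) $ (r, n) * amplify Y $ (r, n) $ (k, l))
      = (if r = i then (if i = k then (X ** Y) $ j $ l else 0) else 0)" for r
    by (simp add: amplify_def matrix_matrix_mult_def)
  then show "(amplify X ** amplify Y) $ (i, j) $ (k, l) = amplify (X ** Y) $ (i, j) $ (k, l)"
    by (simp add: matrix_mult_prod_nth) (simp add: amplify_def)
qed

lemma reassoc_kron_ketbra:
  fixes \<Psi> :: "complex ^ ('r::finite \<times> 'a::finite) ^ ('r \<times> 'a)" and g :: "complex ^ 'n::finite"
  shows "reassoc (kron \<Psi> (ketbra g)) = amplify (attach g) ** \<Psi> ** adj (amplify (attach g))"
proof -
  have "(amplify (attach g) ** \<Psi>) $ (r, i, n) $ q = g $ n * \<Psi> $ (r, i) $ q" for r i n q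
  proof -
    have "(\<Sum>a\<in>UNIV. amplify (attach g) $ (r, i, n) $ (s, a) * \<Psi> $ (s, a) $ q)
        = (if s = r then g $ n * \<Psi> $ (r, i) $ q else 0)" for s
      by (simp add: amplify_def attach_def if_zero_mult sum_if_const cong: if_cong)
    then show ?thesis
      by (simp add: matrix_mult_prod_nth)
  qed
  moreover have "(X ** adj (amplify (attach g))) $ p $ (r, i, n) = X $ p $ (r, i) * cnj (g $ n)" 
    for X :: "complex ^ ('r \<times> 'a) ^ ('r \<times> 'a \<times> 'n)" and p r i n
  proof -
    have "(\<Sum>a\<in>UNIV. X $ p $ (s, a) * adj (amplify (attach g)) $ (s, a) $ (r, i, n))
        = (if s = r then X $ p $ (r, i) * cnj (g $ n) else 0)" for s
      by (simp add: amplify_def attach_def adj_def if_zero_mult sum_if_const cong: if_cong)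
    then show ?thesis
      by (simp add: matrix_mult_prod_nth)
  qed
  ultimately show ?thesis
    by (simp add: vec_eq_iff reassoc_def ketbra_def)
qed

text \<open>The vector got by applying \<open>S\<close> to the first half of the unnormalized
  maximally entangled vector.\<close>

definition vectorize :: "complex ^ 'c::finite ^ 'b::finite \<Rightarrow> complex ^ ('b \<times> 'c)" where
  "vectorize S = (\<chi> p. S $ fst p $ snd p)"

lemma canonical_purification_eq:
  assumes "psd \<sigma>"
  shows "canonical_purification \<sigma> = ketbra (vectorize (psd_sqrt \<sigma>))"
proof -
  let ?S = "kron (psd_sqrt \<sigma>) (mat 1)"
  have "?S *v Gamma = vectorize (psd_sqrt \<sigma>)"
    by (simp add: vec_eq_iff matrix_vector_mult_def sum_UNIV_prod vectorize_def)
      (simp add: Gamma_def mat_def if_zero_mult sum_if_const cong: if_cong)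
  moreover have "A ** ketbra v ** adj A = ketbra (A *v v)" for A :: "complex ^ 'm::finite ^ 'n::finite" and v
  proof -
    have "(A ** ketbra v) $ i $ j = (A *v v) $ i * cnj (v $ j)" for i j
      by (simp add: matrix_matrix_mult_def matrix_vector_mult_def ketbra_def sum_distrib_left sum_distrib_right mult_ac)
    then show ?thesis
      by (simp add: vec_eq_iff matrix_matrix_mult_def[of "A ** ketbra v"])
        (simp add: ketbra_def adj_def matrix_vector_mult_def sum_distrib_left mult_ac)
  qed
  moreover have "adj ?S = ?S"
    using psd_sqrt(1)[OF assms] by (simp add: adj_kron psd_iff)
  ultimately show ?thesis
    by (metis canonical_purification_def)
qed

lemma purifies_canonical_purification:
  assumes "density_op \<sigma>"
  shows "purifies (canonical_purification \<sigma>) \<sigma>"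
proof -
  let ?s = "psd_sqrt \<sigma>"
  have "psd \<sigma>" and tr: "trace \<sigma> = 1"
    using assms by (simp_all add: density_op_def)
  then have ss: "?s ** adj ?s = \<sigma>"
    using psd_sqrt[of \<sigma>] by (simp add: psd_iff)
  have pt: "ptrace_snd (ketbra (vectorize ?s)) = \<sigma>"
    by (subst (2) ss[symmetric])
      (simp add: ptrace_snd_def ketbra_def vectorize_def vec_eq_iff matrix_matrix_mult_def adj_def)
  have "of_real ((norm (vectorize ?s))\<^sup>2) = trace (?s ** adj ?s)"
    by (simp only: sum_cnj_self[symmetric])
      (simp add: sum_UNIV_prod vectorize_def trace_def matrix_matrix_mult_def adj_def mult.commute)
  then have "(norm (vectorize ?s))\<^sup>2 = 1"
    by (simp only: ss tr of_real_eq_1_iff)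
  then have "norm (vectorize ?s) = 1"
    by (simp add: power2_eq_1_iff) (smt (verit) norm_ge_zero)
  then show ?thesis
    unfolding purifies_def canonical_purification_eq[OF \<open>psd \<sigma>\<close>] using pt by blast
qed

lemma on_AB_attach_nth:
  "(on_AB X ** attach (vectorize S)) $ (a, b, c) $ a' = (X ** kron (mat 1) S) $ (a, b) $ (a', c)"
  by (subst mult_kron_id_nth, simp add: matrix_mult_prod_nth[of "on_AB X"] sum_UNIV_prod)
    (simp add: on_AB_def attach_def vectorize_def if_zero_mult sum_if_const cong: if_cong)

text \<open>The operator meets the column index of \<open>S\<close>, hence the transpose and the
  exchange of \<open>b\<close> and \<open>c\<close>.\<close>

lemma on_AC_attach_nth:
  "(on_AC X ** attach (vectorize S)) $ (a, b, c) $ a'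
   = (X ** kron (mat 1) (transpose S)) $ (a, c) $ (a', b)"
  by (subst mult_kron_id_nth, simp add: matrix_mult_prod_nth[of "on_AC X"] sum_UNIV_prod)
    (simp add: on_AC_def attach_def vectorize_def transpose_def if_zero_mult sum_if_const cong: if_cong)

text \<open>The transpose trick: intertwining puts \<open>t\<close> to the left of \<open>U\<close>,
  and reading the same entries with the B and C indices exchanged gives the partial
  transpose.\<close>

lemma on_AB_attach_eq:
  assumes "U ** kron (mat 1) s = kron (mat 1) t ** U"
  shows "on_AB U ** attach (vectorize s) = on_AC (ptranspose_snd U) ** attach (vectorize t)"
  by (simp add: vec_eq_iff on_AB_attach_nth on_AC_attach_nth assms flip: ptranspose_snd_kron_id_mult)

lemma on_AC_mult:
  fixes X Y :: "complex ^ ('a::finite \<times> 'c::finite) ^ ('a \<times> 'c)"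
  shows "on_AC X ** on_AC Y = (on_AC (X ** Y) :: complex ^ ('a \<times> 'b::finite \<times> 'c) ^ ('a \<times> 'b \<times> 'c))"
proof -
  have "(\<Sum>e\<in>UNIV. on_AC X $ (a, b, c) $ (d, k, e) * on_AC Y $ (d, k, e) $ (a', b', c'))
      = (if k = b then (if b = b' then \<Sum>e\<in>UNIV. X $ (a, c) $ (d, e) * Y $ (d, e) $ (a', c') else 0) else 0)"
    for a c a' c' d and b b' k :: 'b
    by (simp add: on_AC_def sum_if_const)
  then show ?thesis
    by (simp add: vec_eq_iff matrix_mult_prod_nth sum_UNIV_prod) (simp add: on_AC_def matrix_mult_prod_nth)
qed

lemma unitary_adj: "unitary U \<Longrightarrow> unitary (adj U)"
  by (simp add: unitary_def)

text \<open>The interaction is the partial transpose acting on the purification of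
  \<open>\<tau>\<close>, so \<open>W\<close> has to undo it on A tensor the range of the transposed
  root. The reference rides along by tensoring with the identity.\<close>

lemma recovery_mapI:
  fixes U :: "complex ^ ('a::finite \<times> 'b::finite) ^ ('a \<times> 'b)"
  assumes "density_op \<sigma>" "density_op \<tau>" "unitary W"
    and out: "\<And>\<rho>. density_op \<rho> \<Longrightarrow> catalyst_out U \<sigma> \<rho> = \<tau>"
    and comm: "U ** kron (mat 1) (psd_sqrt \<sigma>) = kron (mat 1) (psd_sqrt \<tau>) ** U"
    and inv: "W ** ptranspose_snd U ** kron (mat 1) (transpose (psd_sqrt \<tau>))
      = kron (mat 1) (transpose (psd_sqrt \<tau>))"
  shows "recovery_map U (canonical_purification \<sigma>) (canonical_purification \<tau>) W"
proof -
  let ?g = "attach (vectorize (psd_sqrt \<sigma>)) :: complex ^ 'a ^ ('a \<times> 'b \<times> 'b)"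
  let ?h = "attach (vectorize (psd_sqrt \<tau>)) :: complex ^ 'a ^ ('a \<times> 'b \<times> 'b)"
  have "psd \<sigma>" "psd \<tau>"
    using assms(1,2) by (simp_all add: density_op_def)
  have "on_AC W ** (on_AB U ** ?g) = on_AC (W ** ptranspose_snd U) ** ?h"
    by (simp add: on_AB_attach_eq[OF comm] matrix_mul_assoc on_AC_mult)
  also have "\<dots> = ?h"
    using on_AC_attach_nth[of "mat 1" "psd_sqrt \<tau>"]
    by (simp add: vec_eq_iff on_AC_attach_nth inv) (simp add: attach_def vectorize_def transpose_def mat_def)
  finally have step: "on_AC W ** (on_AB U ** ?g) = ?h" .
  have "conj_by (kron (mat 1) (on_AC W)) (conj_by (kron (mat 1) (on_AB U))
          (reassoc (kron \<Psi> (canonical_purification \<sigma>))))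
      = reassoc (kron \<Psi> (canonical_purification \<tau>))" for \<Psi> :: "complex ^ ('a \<times> 'a) ^ ('a \<times> 'a)"
  proof -
    have conj_amplify: "conj_by (kron (mat 1) X) (amplify G ** \<Psi> ** adj (amplify G))
        = amplify (X ** G) ** \<Psi> ** adj (amplify (X ** G))"
      for X :: "complex ^ ('a \<times> 'b \<times> 'b) ^ ('a \<times> 'b \<times> 'b)" and G :: "complex ^ 'a ^ ('a \<times> 'b \<times> 'b)"
      by (simp add: conj_by_def kron_id_eq_amplify adj_mult matrix_mul_assoc flip: amplify_mult)
    show ?thesis
      by (simp only: canonical_purification_eq[OF \<open>psd \<sigma>\<close>] canonical_purification_eq[OF \<open>psd \<tau>\<close>]
          reassoc_kron_ketbra conj_amplify step)
  qed
  moreover have "ptrace_snd (canonical_purification \<sigma>) = \<sigma>"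
    using purifies_canonical_purification[OF assms(1)] by (simp add: purifies_def)
  ultimately show ?thesis
    using assms(2,3) out by (simp add: recovery_map_def purifies_canonical_purification)
qed

text \<open>Tensoring with a pure state is conjugation by \<open>attach\<close>, so
  \<open>on_AB_attach_eq\<close> suffices.\<close>

lemma conj_attach:
  assumes "psd \<sigma>" "psd \<tau>"
    and "U ** kron (mat 1) (psd_sqrt \<sigma>) = kron (mat 1) (psd_sqrt \<tau>) ** U"
  shows "on_AB U ** kron \<kappa> (canonical_purification \<sigma>) ** adj (on_AB U)
    = on_AC (ptranspose_snd U) ** kron \<kappa> (canonical_purification \<tau>) ** adj (on_AC (ptranspose_snd U))"
proof -
  have conj: "M ** (G ** \<kappa> ** adj G) ** adj M = (M ** G) ** \<kappa> ** adj (M ** G)"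
    for M :: "complex ^ 'n::finite ^ 'n" and G :: "complex ^ 'm::finite ^ 'n" and \<kappa>
    by (simp add: adj_mult matrix_mul_assoc)
  show ?thesis
    unfolding canonical_purification_eq[OF assms(1)] canonical_purification_eq[OF assms(2)]
      kron_ketbra conj on_AB_attach_eq[OF assms(3)] ..
qed

section \<open>Recovery for a catalysis, with and without full rank\<close>

theorem mainTheorem18:
  fixes U :: "complex ^ ('a::finite \<times> 'b::finite) ^ ('a \<times> 'b)"
    and \<sigma> \<tau> :: "complex ^ 'b ^ 'b"
  assumes "density_op \<sigma>"
    and "catalysis_unitary U \<sigma>"
    and "\<forall>\<rho>. density_op \<rho> \<longrightarrow> catalyst_out U \<sigma> \<rho> = \<tau>"
  shows
    "purifies (canonical_purification \<sigma>) \<sigma> \<and>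
     \<comment> \<open>catalyst returned in the state \<sigma>: commutation and the displayed identity\<close>
     (U ** kron (mat 1) \<sigma> = kron (mat 1) \<sigma> ** U \<longleftrightarrow> \<tau> = \<sigma>) \<and>
     (U ** kron (mat 1) \<sigma> = kron (mat 1) \<sigma> ** U \<longrightarrow>
       (\<forall>\<kappa>. density_op \<kappa> \<longrightarrow>
          on_AB U ** kron \<kappa> (canonical_purification \<sigma>) ** adj (on_AB U)
          = on_AC (ptranspose_snd U) ** kron \<kappa> (canonical_purification \<sigma>)
              ** adj (on_AC (ptranspose_snd U)))) \<and>
     \<comment> \<open>arbitrary final state \<tau> of the catalyst\<close>
     U ** kron (mat 1) \<sigma> = kron (mat 1) \<tau> ** U \<and>
     (\<forall>\<kappa>. density_op \<kappa> \<longrightarrow>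
        on_AB U ** kron \<kappa> (canonical_purification \<sigma>) ** adj (on_AB U)
        = on_AC (ptranspose_snd U) ** kron \<kappa> (canonical_purification \<tau>)
            ** adj (on_AC (ptranspose_snd U))) \<and>
     \<comment> \<open>recovery undoes the partial transpose, so it is the adjoint that is applied\<close>
     (invertible \<sigma> \<longrightarrow>
        unitary (ptranspose_snd U) \<and>
        recovery_map U (canonical_purification \<sigma>) (canonical_purification \<tau>)
          (adj (ptranspose_snd U))) \<and>
     \<comment> \<open>\<open>\<sigma>\<close> not of full rank: the same on \<open>A\<close> tensor the range of
       \<open>\<sigma>\<close> transposed, where the final state on \<open>AC\<close> lives\<close>
     (\<exists>W. recovery_map U (canonical_purification \<sigma>) (canonical_purification \<tau>) W \<and>
          W ** kron (mat 1) (transpose \<sigma>)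
          = adj (ptranspose_snd U) ** kron (mat 1) (transpose \<sigma>))"
proof -
  obtain V where "unitary U" "unitary V"
    and V: "\<And>\<rho>. density_op \<rho> \<Longrightarrow> catalyst_out U \<sigma> \<rho> = conj_by V \<sigma>"
    using assms(2) by (auto simp: catalysis_unitary_def)
  have out: "\<And>\<rho>. density_op \<rho> \<Longrightarrow> catalyst_out U \<sigma> \<rho> = \<tau>"
    using assms(3) by blast
  have \<tau>: "\<tau> = conj_by V \<sigma>"
    using V[OF density_op_maximally_mixed] out[OF density_op_maximally_mixed] by simp
  have "density_op \<tau>"
    using density_op_conj_by[OF \<open>unitary V\<close> assms(1)] \<tau> by simp
  then have "psd \<sigma>" "psd \<tau>"
    using assms(1) by (simp_all add: density_op_def)
  have conj: "conj_by U (kron (mat 1) \<sigma>) = kron (mat 1) \<tau>"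
    using catalysis_conj[OF \<open>unitary U\<close> \<open>unitary V\<close> \<tau> out] .
  then have comm: "U ** kron (mat 1) \<sigma> = kron (mat 1) \<tau> ** U"
    by (simp add: conj_by_eq_iff \<open>unitary U\<close>)
  \<comment> \<open>By uniqueness of positive roots, conjugation by \<open>U\<close> carries root to
    root.\<close>
  have "conj_by U (kron (mat 1) (psd_sqrt \<sigma>)) = kron (mat 1) (psd_sqrt \<tau>)"
    using psd_sqrt_conj_by[OF \<open>unitary U\<close> psd_kron_id[OF \<open>psd \<sigma>\<close>]]
    by (simp add: conj psd_sqrt_kron_id \<open>psd \<sigma>\<close> \<open>psd \<tau>\<close>)
  then have comm_sqrt: "U ** kron (mat 1) (psd_sqrt \<sigma>) = kron (mat 1) (psd_sqrt \<tau>) ** U"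
    by (simp add: conj_by_eq_iff \<open>unitary U\<close>)
  \<comment> \<open>In general \<open>\<tau>\<close> is only unitarily equivalent to
    \<open>\<sigma>\<close>, so the right side carries its purification; \<open>fixed\<close>
    singles out the case of equality.\<close>
  note displayed = conj_attach[OF \<open>psd \<sigma>\<close> \<open>psd \<tau>\<close> comm_sqrt]
  have fixed: "U ** kron (mat 1) \<sigma> = kron (mat 1) \<sigma> ** U \<longleftrightarrow> \<tau> = \<sigma>"
    unfolding conj_by_eq_iff[OF \<open>unitary U\<close>, symmetric] conj
    using kron_id_inject by blast

  let ?M = "ptranspose_snd U"
  obtain P where P: "support_proj \<sigma> P"
    using psd_sqrt_and_support_exist[OF \<open>psd \<sigma>\<close>] by blast
  define Q where "Q = conj_by V P"
  have Q: "support_proj \<tau> Q"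
    using support_proj_conj_by[OF \<open>unitary V\<close> P] by (simp add: Q_def \<tau>)
  \<comment> \<open>Both sides are support projections of
    \<open>kron (mat 1) \<tau>\<close>.\<close>
  have "conj_by U (kron (mat 1) P) = kron (mat 1) Q"
    using support_proj_conj_by[OF \<open>unitary U\<close> support_proj_kron_id[OF P]]
      support_proj_kron_id[OF Q] by (simp add: conj) (rule support_proj_unique)
  then have comm_supp: "U ** kron (mat 1) P = kron (mat 1) Q ** U"
    by (simp add: conj_by_eq_iff \<open>unitary U\<close>)
  \<comment> \<open>Partial transposition will turn intertwining by \<open>P\<close> and
    \<open>Q\<close> into \<open>?M ** q = p ** ?M\<close>, whence the transposes.\<close>
  define p q where "p = kron (mat 1 :: complex ^ 'a ^ 'a) (transpose P)"
    and "q = kron (mat 1 :: complex ^ 'a ^ 'a) (transpose Q)"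
  have adj_transpose: "adj (transpose X) = transpose (adj X)" for X :: "complex ^ 'b ^ 'b"
    by (simp add: adj_def transpose_def vec_eq_iff)
  \<comment> \<open>\<open>transpose (adj V)\<close> is the entrywise conjugate of \<open>V\<close>;
    conjugation by it takes \<open>transpose P\<close> to \<open>transpose Q\<close>.\<close>
  have V': "unitary (kron (mat 1 :: complex ^ 'a ^ 'a) (transpose (adj V)))"
    using \<open>unitary V\<close> by (intro unitary_kron_id)
      (simp add: unitary_def adj_transpose flip: matrix_transpose_mul)
  have q_conj: "q = conj_by (kron (mat 1) (transpose (adj V))) p"
    by (simp add: q_def p_def Q_def conj_by_kron_id)
      (simp add: conj_by_def adj_transpose matrix_transpose_mul matrix_mul_assoc)
  have adjp: "adj p = p" and pp: "p ** p = p"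
    using P support_proj_idem[OF P] by (simp_all add: p_def adj_kron adj_transpose support_proj_def kron_mult
        flip: matrix_transpose_mul)
  have inter: "?M ** q = p ** ?M"
    by (simp add: p_def q_def comm_supp flip: ptranspose_snd_kron_id_mult ptranspose_snd_mult_kron_id)
  have supp_mult: "kron (mat 1) (transpose Y) ** kron (mat 1) (transpose X) = kron (mat 1) (transpose (X ** Y))"
    for X Y :: "complex ^ 'b ^ 'b"
    by (simp add: kron_mult matrix_transpose_mul)
  \<comment> \<open>\<open>q\<close> factors through \<open>kron (mat 1) (transpose \<tau>)\<close>,
    which \<open>adj ?M ** ?M\<close> fixes.\<close>
  have iso: "adj ?M ** ?M ** q = q"
  proof -
    obtain X where "Q = X ** \<tau>"
      using Q by (auto simp: support_proj_def)
    then have "q = kron (mat 1) (transpose \<tau>) ** kron (mat 1) (transpose X)"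
      by (simp add: q_def supp_mult)
    then show ?thesis
      using adj_mult_ptranspose[OF out comm] by (simp add: matrix_mul_assoc)
  qed
  obtain W where W: "unitary W" "W ** ?M ** q = q" "W ** p = adj ?M ** p"
    using partial_isometry_extends[OF V' q_conj adjp pp inter iso] .
  \<comment> \<open>The defect \<open>?D\<close> has zero norm since \<open>\<tau>\<close> vanishes
    off \<open>Q\<close>; so \<open>Q\<close> supports the root too.\<close>
  have "psd_sqrt \<tau> ** Q = psd_sqrt \<tau>"
  proof -
    let ?D = "psd_sqrt \<tau> - psd_sqrt \<tau> ** Q"
    have t: "psd_sqrt \<tau> ** psd_sqrt \<tau> = \<tau>" "adj (psd_sqrt \<tau>) = psd_sqrt \<tau>"
      using psd_sqrt[OF \<open>psd \<tau>\<close>] by (simp_all add: psd_iff)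
    have "adj ?D ** ?D = (mat 1 - Q) ** (psd_sqrt \<tau> ** psd_sqrt \<tau>) ** (mat 1 - Q)"
      using Q by (simp add: support_proj_def adj_diff adj_mult t(2) matrix_distribs matrix_mul_assoc)
    also have "\<dots> = 0"
      using Q by (simp add: t support_proj_def matrix_distribs flip: matrix_mul_assoc)
    finally show ?thesis
      using adj_mult_self_eq_0 by fastforce
  qed
  then have supp_sqrt: "q ** kron (mat 1) (transpose (psd_sqrt \<tau>)) = kron (mat 1) (transpose (psd_sqrt \<tau>))"
    by (simp add: q_def supp_mult)
  have "W ** ?M ** (q ** kron (mat 1) (transpose (psd_sqrt \<tau>))) = q ** kron (mat 1) (transpose (psd_sqrt \<tau>))"
    using W(2) by (simp add: matrix_mul_assoc)
  then have recovers: "recovery_map U (canonical_purification \<sigma>) (canonical_purification \<tau>) W"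
    using recovery_mapI[OF assms(1) \<open>density_op \<tau>\<close> W(1) out comm_sqrt] by (simp add: supp_sqrt)
  have "p ** kron (mat 1) (transpose \<sigma>) = kron (mat 1) (transpose \<sigma>)"
    using P by (simp add: p_def supp_mult support_proj_def)
  then have W_supp: "W ** kron (mat 1) (transpose \<sigma>) = adj ?M ** kron (mat 1) (transpose \<sigma>)"
    using W(3) by (metis matrix_mul_assoc)
  have full_rank: "unitary ?M \<and> recovery_map U (canonical_purification \<sigma>) (canonical_purification \<tau>) (adj ?M)"
    if "invertible \<sigma>"
  proof -
    obtain R where "\<sigma> ** R = mat 1" "R ** \<sigma> = mat 1"
      using \<open>invertible \<sigma>\<close> by (auto simp: invertible_def)
    \<comment> \<open>At full rank the transposed \<open>\<sigma>\<close> cancels from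
      \<open>W_supp\<close>, so \<open>W\<close> is the adjoint of the partial transpose, and
      unitarity of \<open>W\<close> passes to \<open>?M\<close>.\<close>
    then have "kron (mat 1 :: complex ^ 'a ^ 'a) (transpose \<sigma>) ** kron (mat 1) (transpose R) = mat 1"
      by (simp add: supp_mult transpose_mat)
    then have "W = adj ?M"
      using W_supp by (metis matrix_mul_assoc matrix_mul_rid)
    then show ?thesis
      using recovers W(1) unitary_adj by force
  qed
  show ?thesis
    using purifies_canonical_purification[OF assms(1)] fixed displayed comm full_rank recovers W_supp
    by blast
qed

end
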